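(* Let $\Phi_1,\Phi_2,\Phi_3$ be Young functions. If there exists a non-zero continuous and integrable function $M\in\tilde{\mathcal M}_{(\Phi_1,\Phi_2,\Phi_3)}(\mathbb R)$, then $$\liminf_{\lambda\to 0^+}\ C_{\Phi_1}(\lambda)\,C_{\Phi_2}(\lambda)\,C_{\Phi_3}\left(\tfrac1\lambda\right)>0$$ and $$\liminf_{\lambda\to\infty}\ \lambda\, C_{\Phi_1}(\lambda)\,C_{\Phi_2}(\lambda)\,C_{\Phi_3}\left(\tfrac1\lambda\right)>0.$$
   Context: A Young function is a function $\Phi:\mathbb R\to[0,\infty]$, not identically zero, which is convex, even and satisfies $\Phi(0)=0$; it is assumed that $L^\Phi(\mathbb R)\ne\{0\}$, i.e. $\Phi(x)<\infty$ for some $x>0$. The Orlicz space $L^\Phi(\mathbb R)$ consists of the measurable $f:\mathbb R\to\mathbb C$ (modulo a.e. equality) with $\int_{\mathbb R}\Phi(|f(x)|/\lambda)\,dx<\infty$ for some $\lambda>0$, with the Luxemburg norm $N_\Phi(f)=\inf\{\lambda>0:\int_{\mathbb R}\Phi(|f(x)|/\lambda)\,dx\le 1\}$. For $\lambda>0$, $D_\lambda f(x)=f(\lambda x)$ and $C_\Phi(\lambda)=\|D_\lambda\|_{L^\Phi(\mathbb R)\to L^\Phi(\mathbb R)}$ is its operator norm with respect to $N_\Phi$. The Fourier transform is $\hat f(\xi)=\int_{\mathbb R}f(x)e^{-2\pi i x\xi}\,dx$, and $\mathcal P(\mathbb R)$ is the set of $f\in L^1(\mathbb R)$ such that $\operatorname{supp}\hat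 f$ is compact. $\tilde{\mathcal M}_{(\Phi_1,\Phi_2,\Phi_3)}(\mathbb R)$ is the space of locally integrable functions $M:\mathbb R\to\mathbb C$ (modulo a.e. equality) for which there is a constant $C>0$ such that the bilinear map $$B_M(f,g)(x)=\int_{\mathbb R}\int_{\mathbb R}\hat f(\xi)\hat g(\eta)M(\xi-\eta)e^{2\pi i(\xi+\eta)x}\,d\xi\,d\eta$$ satisfies $N_{\Phi_3}(B_M(f,g))\le C\,N_{\Phi_1}(f)N_{\Phi_2}(g)$ for all $f,g\in\mathcal P(\mathbb R)$. *)

theory Defs
  imports "HOL-Analysis.Analysis"
begin

(* The last conjunct is the standing assumption that the Orlicz space of Phi is non-trivial. *)
definition young :: "(real \<Rightarrow> ennreal) \<Rightarrow> bool" where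
  "young \<Phi> \<longleftrightarrow>
     (\<exists>x. \<Phi> x \<noteq> 0) \<and>
     (\<forall>x y. \<forall>t\<in>{0..1}.
        \<Phi> (t * x + (1 - t) * y) \<le> ennreal t * \<Phi> x + ennreal (1 - t) * \<Phi> y) \<and>
     (\<forall>x. \<Phi> (- x) = \<Phi> x) \<and>
     \<Phi> 0 = 0 \<and>
     (\<exists>x>0. \<Phi> x < \<infinity>)"

(* Functions are not identified modulo a.e. equality: every notion below that is applied to
   them is invariant under changes on null sets. *)
definition orlicz_space :: "(real \<Rightarrow> ennreal) \<Rightarrow> (real \<Rightarrow> complex) set" where
  "orlicz_space \<Phi> =
     {f \<in> borel_measurable lebesgue. \<exists>s>0. (\<integral>\<^sup>+x. \<Phi> (cmod (f x) / s) \<partial>lebesgue) < \<infinity>}"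

(* The infimum is taken in ennreal, so the value is infinite outside the Orlicz space. *)
definition lux_norm :: "(real \<Rightarrow> ennreal) \<Rightarrow> (real \<Rightarrow> complex) \<Rightarrow> ennreal" where
  "lux_norm \<Phi> f =
     Inf (ennreal ` {s. s > 0 \<and> (\<integral>\<^sup>+x. \<Phi> (cmod (f x) / s) \<partial>lebesgue) \<le> 1})"

definition orlicz_opnorm ::
    "(real \<Rightarrow> ennreal) \<Rightarrow> (real \<Rightarrow> ennreal) \<Rightarrow>
     ((real \<Rightarrow> complex) \<Rightarrow> (real \<Rightarrow> complex)) \<Rightarrow> ennreal" where
  "orlicz_opnorm \<Phi> \<Psi> T = (SUP f \<in> {f \<in> orlicz_space \<Phi>. lux_norm \<Phi> f \<le> 1}. lux_norm \<Psi> (T f))"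

definition dilation :: "real \<Rightarrow> (real \<Rightarrow> complex) \<Rightarrow> (real \<Rightarrow> complex)" where
  "dilation l f = (\<lambda>x. f (l * x))"

definition dil_norm :: "(real \<Rightarrow> ennreal) \<Rightarrow> real \<Rightarrow> ennreal" where
  "dil_norm \<Phi> l = orlicz_opnorm \<Phi> \<Phi> (dilation l)"

definition fourier :: "(real \<Rightarrow> complex) \<Rightarrow> (real \<Rightarrow> complex)" where
  "fourier f = (\<lambda>\<xi>. LINT x|lebesgue. f x * exp (- 2 * of_real pi * \<i> * of_real x * of_real \<xi>))"

definition paley_wiener :: "(real \<Rightarrow> complex) set" where
  "paley_wiener = {f. integrable lebesgue f \<and> compact (closure {\<xi>. fourier f \<xi> \<noteq> 0})}"

definition bilinear_op ::
    "(real \<Rightarrow> complex) \<Rightarrow> (real \<Rightarrow> complex) \<Rightarrow> (real \<Rightarrow> complex) \<Rightarrow> (real \<Rightarrow> complex)" where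
  "bilinear_op M f g =
     (\<lambda>x. LINT \<eta>|lebesgue. LINT \<xi>|lebesgue.
        fourier f \<xi> * fourier g \<eta> * M (\<xi> - \<eta>) *
        exp (2 * of_real pi * \<i> * of_real (\<xi> + \<eta>) * of_real x))"

definition bilinear_multipliers ::
    "(real \<Rightarrow> ennreal) \<Rightarrow> (real \<Rightarrow> ennreal) \<Rightarrow> (real \<Rightarrow> ennreal) \<Rightarrow> (real \<Rightarrow> complex) set" where
  "bilinear_multipliers \<Phi>1 \<Phi>2 \<Phi>3 =
     {M. (\<forall>K. compact K \<longrightarrow> M absolutely_integrable_on K) \<and>
         (\<exists>C::real. C > 0 \<and>
            (\<forall>f\<in>paley_wiener. \<forall>g\<in>paley_wiener.
               lux_norm \<Phi>3 (bilinear_op M f g) \<le> ennreal C * lux_norm \<Phi>1 f * lux_norm \<Phi>2 g))}"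

end

theory Submission imports Defs "HOL-Probability.Sinc_Integral"
begin

text \<open>
  The idea is to test the multiplier on functions of scale \<open>l\<close> and to undo the scale afterwards.
  If \<open>f\<close> and \<open>g\<close> are dilates by \<open>l\<close> of one fixed kernel, up to modulations and translations,
  then their norms are at most \<^term>\<open>dil_norm \<Phi>1 l\<close> and \<^term>\<open>dil_norm \<Phi>2 l\<close> times constants,
  and dilating \<^term>\<open>bilinear_op M f g\<close> back costs \<^term>\<open>dil_norm \<Phi>3 (1 / l)\<close>. So the product of the
  three dilation norms is bounded below as soon as the dilated output is bounded below on a fixed
  interval (multiplier_scaling).

  The kernel is the Fejer kernel. It lies in every Orlicz space, and its Fourier transform is a
  positive multiple of the tent function, which is compactly supported. Positivity of the tent keeps
  the limits below from vanishing.

  For small \<open>l\<close>, choose \<open>a\<close> with \<^term>\<open>M a \<noteq> (0::complex)\<close> and modulate the first function by \<open>a\<close>. Both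
  Fourier transforms concentrate, the multiplier tends to the constant \<^term>\<open>M a\<close>, and the rescaled
  output at the origin tends to \<^term>\<open>M a\<close> times a positive number, up to a factor of modulus 1.

  For large \<open>l\<close>, the Fourier transforms are so spread out that \<open>l M(l \<cdot>)\<close> acts as a point mass whose
  size is the integral of \<^term>\<open>M\<close>. That integral may vanish, but the Fourier transform of \<^term>\<open>M\<close>
  does not vanish everywhere (fourier_nonzero_somewhere), and translating the two functions in opposite directions
  multiplies \<^term>\<open>M\<close> by the corresponding character. The point mass produces the extra factor \<open>l\<close>.

  In both regimes a lower bound at the origin alone would not suffice. It extends to an interval,
  uniformly in \<open>l\<close>, because the output is an integral depending continuously on the rescaled variable
  and on the parameter \<open>l\<close> or \<open>1 / l\<close> (iterated_integral_bounded_below).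
\<close>

section \<open>Young functions and the Luxemburg norm\<close>

text \<open>Convexity between \<^term>\<open>x\<close> and \<^term>\<open>0::real\<close>, where a Young function vanishes. With evenness this gives
  monotonicity in \<^term>\<open>\<bar>x::real\<bar>\<close>, and it turns every bound on a modular into a bound on a norm.\<close>

lemma young_scale:
  assumes "young \<Phi>" "0 \<le> t" "t \<le> 1"
  shows "\<Phi> (t * x) \<le> ennreal t * \<Phi> x"
proof -
  have "\<Phi> (t * x + (1 - t) * 0) \<le> ennreal t * \<Phi> x + ennreal (1 - t) * \<Phi> 0"
    using assms unfolding young_def by (metis atLeastAtMost_iff)
  moreover have "\<Phi> 0 = 0" using assms by (simp add: young_def)
  ultimately show ?thesis by simp
qed

lemma young_divide:
  assumes "young \<Phi>" "k \<ge> 1"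
  shows "\<Phi> (a / (k * s)) \<le> ennreal (1 / k) * \<Phi> (a / s)"
  using young_scale[OF assms(1), of "1 / k" "a / s"] assms(2) by simp

lemma young_abs: "young \<Phi> \<Longrightarrow> \<Phi> \<bar>x\<bar> = \<Phi> x"
  by (simp add: young_def abs_if)

lemma young_mono:
  assumes "young \<Phi>" "\<bar>x\<bar> \<le> \<bar>y\<bar>"
  shows "\<Phi> x \<le> \<Phi> y"
proof (cases "y = 0")
  case True
  then show ?thesis using assms by simp
next
  case False
  define t where "t = \<bar>x\<bar> / \<bar>y\<bar>"
  have t: "0 \<le> t" "t \<le> 1" "\<bar>x\<bar> = t * \<bar>y\<bar>"
    using assms(2) False by (auto simp: t_def)
  have "\<Phi> x = \<Phi> (t * \<bar>y\<bar>)" using young_abs[OF assms(1)] t(3) by metis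
  also have "\<dots> \<le> ennreal t * \<Phi> \<bar>y\<bar>" by (rule young_scale[OF assms(1) t(1,2)])
  also have "\<dots> \<le> 1 * \<Phi> \<bar>y\<bar>" using t by (intro mult_right_mono) auto
  finally show ?thesis using young_abs[OF assms(1)] by simp
qed

text \<open>By monotonicity in the absolute value the sublevel sets are intervals.\<close>

lemma young_measurable:
  assumes "young \<Phi>"
  shows "\<Phi> \<in> borel_measurable borel"
proof (rule borel_measurableI_less)
  fix a
  have "is_interval {x. \<Phi> x < a}"
    unfolding is_interval_1
  proof clarify
    fix x y z assume "\<Phi> x < a" "\<Phi> y < a" "x \<le> z" "z \<le> y"
    then have "\<bar>z\<bar> \<le> \<bar>x\<bar> \<or> \<bar>z\<bar> \<le> \<bar>y\<bar>" by linarith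
    then show "\<Phi> z < a"
      using young_mono[OF assms] \<open>\<Phi> x < a\<close> \<open>\<Phi> y < a\<close> le_less_trans by blast
  qed
  then show "{x \<in> space borel. \<Phi> x < a} \<in> sets borel"
    using real_interval_borel_measurable by simp
qed

text \<open>Every norm comparison below (monotonicity, homogeneity, translation, dilation) is obtained
  from this rule, which reduces it to a comparison of the modulars.\<close>

lemma lux_norm_le_cmult:
  assumes "c > 0"
    and "\<And>s. s > 0 \<Longrightarrow> (\<integral>\<^sup>+x. \<Phi> (cmod (f x) / s) \<partial>lebesgue) \<le> 1 \<Longrightarrow>
           (\<integral>\<^sup>+x. \<Phi> (cmod (g x) / (c * s)) \<partial>lebesgue) \<le> 1"
  shows "lux_norm \<Phi> g \<le> ennreal c * lux_norm \<Phi> f"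
proof -
  have "lux_norm \<Phi> g / ennreal c \<le> lux_norm \<Phi> f"
    unfolding lux_norm_def[of _ f]
  proof (rule Inf_greatest, clarify)
    fix s :: real assume s: "0 < s" "(\<integral>\<^sup>+x. \<Phi> (cmod (f x) / s) \<partial>lebesgue) \<le> 1"
    have "lux_norm \<Phi> g \<le> ennreal (c * s)"
      unfolding lux_norm_def using assms s by (intro Inf_lower) auto
    then show "lux_norm \<Phi> g / ennreal c \<le> ennreal s"
      using assms s by (simp add: divide_le_posI_ennreal ennreal_mult)
  qed
  then have "ennreal c * (lux_norm \<Phi> g / ennreal c) \<le> ennreal c * lux_norm \<Phi> f"
    by (rule mult_left_mono) simp
  moreover have "ennreal c * (lux_norm \<Phi> g / ennreal c) = lux_norm \<Phi> g"
    using assms(1) ennreal_mult_divide_eq[of "ennreal c" "lux_norm \<Phi> g"]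
    by (simp add: ennreal_times_divide mult.commute)
  ultimately show ?thesis by simp
qed

lemma lux_norm_mono:
  assumes "young \<Phi>" "\<And>x. cmod (g x) \<le> cmod (f x)"
  shows "lux_norm \<Phi> g \<le> lux_norm \<Phi> f"
proof -
  have "lux_norm \<Phi> g \<le> ennreal 1 * lux_norm \<Phi> f"
  proof (rule lux_norm_le_cmult)
    fix s :: real assume s: "0 < s" "(\<integral>\<^sup>+x. \<Phi> (cmod (f x) / s) \<partial>lebesgue) \<le> 1"
    have "(\<integral>\<^sup>+x. \<Phi> (cmod (g x) / (1 * s)) \<partial>lebesgue) \<le> (\<integral>\<^sup>+x. \<Phi> (cmod (f x) / s) \<partial>lebesgue)"
      using s assms by (intro nn_integral_mono young_mono) (auto simp: field_simps)
    then show "(\<integral>\<^sup>+x. \<Phi> (cmod (g x) / (1 * s)) \<partial>lebesgue) \<le> 1" using s by simp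
  qed simp
  then show ?thesis by simp
qed

lemma lux_norm_cmult_le:
  assumes "t > 0"
  shows "lux_norm \<Phi> (\<lambda>x. of_real t * f x) \<le> ennreal t * lux_norm \<Phi> f"
  using assms by (intro lux_norm_le_cmult) (auto simp: norm_mult)

lemma young_lebesgue_measurable:
  fixes f :: "real \<Rightarrow> complex"
  assumes "young \<Phi>" "f \<in> borel_measurable lebesgue"
  shows "(\<lambda>x. \<Phi> (cmod (f x) / s)) \<in> borel_measurable lebesgue"
  by (rule measurable_compose[OF _ young_measurable[OF assms(1)]]) (use assms(2) in measurable)

lemma nn_integral_dilation:
  assumes "l > 0" "f \<in> borel_measurable lebesgue"
  shows "(\<integral>\<^sup>+x. f (l * x) \<partial>lebesgue) = ennreal (1 / l) * (\<integral>\<^sup>+x. f x \<partial>lebesgue)"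
proof -
  have "(\<integral>\<^sup>+x. f x \<partial>lebesgue) = ennreal \<bar>l\<bar> * (\<integral>\<^sup>+x. f (0 + l * x) \<partial>lebesgue)"
    using assms by (intro nn_integral_real_affine_lebesgue) auto
  then have "ennreal (1 / l) * (\<integral>\<^sup>+x. f x \<partial>lebesgue)
      = (ennreal (1 / l) * ennreal l) * (\<integral>\<^sup>+x. f (l * x) \<partial>lebesgue)"
    using assms by (simp add: mult.assoc)
  also have "ennreal (1 / l) * ennreal l = 1"
    using assms by (simp flip: ennreal_mult)
  finally show ?thesis by simp
qed

text \<open>For \<^term>\<open>l \<ge> (1::real)\<close> the change of variables contracts the modular. For \<^term>\<open>l < (1::real)\<close> it
  multiplies the modular by \<^term>\<open>1 / l :: real\<close>, which convexity compensates once the function has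
  been divided by \<^term>\<open>1 / l :: real\<close>.\<close>

lemma lux_norm_dilation_le:
  assumes "young \<Phi>" "l > 0" "f \<in> borel_measurable lebesgue"
  shows "lux_norm \<Phi> (dilation l f) \<le> ennreal (max 1 (1 / l)) * lux_norm \<Phi> f"
proof (rule lux_norm_le_cmult)
  show "0 < max 1 (1 / l)" by simp
  fix s :: real assume s: "0 < s" "(\<integral>\<^sup>+x. \<Phi> (cmod (f x) / s) \<partial>lebesgue) \<le> 1"
  define c where "c = max 1 (1 / l)"
  have c: "1 \<le> c" "1 / l \<le> c" by (auto simp: c_def)
  have "(\<integral>\<^sup>+x. \<Phi> (cmod (dilation l f x) / (c * s)) \<partial>lebesgue)
      \<le> (\<integral>\<^sup>+x. ennreal (1 / c) * \<Phi> (cmod (f (l * x)) / s) \<partial>lebesgue)"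
    unfolding dilation_def using c by (intro nn_integral_mono young_divide assms)
  also have "\<dots> = ennreal (1 / l) * (\<integral>\<^sup>+x. ennreal (1 / c) * \<Phi> (cmod (f x) / s) \<partial>lebesgue)"
    by (rule nn_integral_dilation[OF assms(2)])
      (intro borel_measurable_times_ennreal borel_measurable_const young_lebesgue_measurable assms)
  also have "\<dots> = ennreal (1 / l) * (ennreal (1 / c) * (\<integral>\<^sup>+x. \<Phi> (cmod (f x) / s) \<partial>lebesgue))"
    by (subst nn_integral_cmult) (auto intro: young_lebesgue_measurable assms)
  also have "\<dots> \<le> ennreal (1 / l) * (ennreal (1 / c) * 1)"
    by (intro mult_left_mono s) auto
  also have "\<dots> = ennreal (1 / l * (1 / c))"
    using c assms by (subst ennreal_mult) auto
  also have "\<dots> \<le> 1"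
    using c assms by (simp add: field_simps ennreal_le_1)
  finally show "(\<integral>\<^sup>+x. \<Phi> (cmod (dilation l f x) / (max 1 (1 / l) * s)) \<partial>lebesgue) \<le> 1"
    by (simp add: c_def)
qed

lemma lux_norm_finite:
  assumes "young \<Phi>" "f \<in> orlicz_space \<Phi>"
  shows "lux_norm \<Phi> f < \<infinity>"
proof -
  obtain s where s: "s > 0" "(\<integral>\<^sup>+x. \<Phi> (cmod (f x) / s) \<partial>lebesgue) < \<infinity>"
    and f: "f \<in> borel_measurable lebesgue"
    using assms(2) unfolding orlicz_space_def by auto
  then obtain r where r: "r \<ge> 0" "(\<integral>\<^sup>+x. \<Phi> (cmod (f x) / s) \<partial>lebesgue) = ennreal r"
    by (auto simp: less_top_ennreal)
  define k where "k = max 1 r"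
  have k: "k \<ge> 1" "k \<ge> r" by (auto simp: k_def)
  have "(\<integral>\<^sup>+x. \<Phi> (cmod (f x) / (k * s)) \<partial>lebesgue)
      \<le> (\<integral>\<^sup>+x. ennreal (1 / k) * \<Phi> (cmod (f x) / s) \<partial>lebesgue)"
    using k by (intro nn_integral_mono young_divide assms)
  also have "\<dots> = ennreal (1 / k) * ennreal r"
    by (subst nn_integral_cmult) (auto intro: young_lebesgue_measurable assms f simp: r)
  also have "\<dots> = ennreal (1 / k * r)"
    using r k by (intro ennreal_mult[symmetric]) auto
  also have "\<dots> \<le> 1"
    using k by (simp add: field_simps ennreal_le_1)
  finally have "lux_norm \<Phi> f \<le> ennreal (k * s)"
    unfolding lux_norm_def using k s by (intro Inf_lower) auto
  also have "\<dots> < \<infinity>" by simp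
  finally show ?thesis .
qed

lemma orlicz_space_if_lux_norm_finite:
  assumes "f \<in> borel_measurable lebesgue" "lux_norm \<Phi> f < \<infinity>"
  shows "f \<in> orlicz_space \<Phi>"
proof -
  obtain s where "s > 0" "(\<integral>\<^sup>+x. \<Phi> (cmod (f x) / s) \<partial>lebesgue) \<le> 1"
    using assms(2) unfolding lux_norm_def by (auto simp: Inf_less_iff)
  moreover have "(1::ennreal) < \<infinity>" by simp
  ultimately show ?thesis
    unfolding orlicz_space_def using assms(1) le_less_trans by blast
qed

lemma dilation_measurable:
  "l \<noteq> 0 \<Longrightarrow> f \<in> borel_measurable lebesgue \<Longrightarrow> dilation l f \<in> borel_measurable lebesgue"
  unfolding dilation_def
  using measurable_compose[OF lebesgue_affine_measurable[where c="\<lambda>x::real. l" and t=0], of f]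
  by simp

text \<open>Normalising \<^term>\<open>f\<close> fails when its norm is 0, and then the product on the right is 0 even if
  \<^term>\<open>dil_norm \<Phi> l\<close> is infinite. The crude bound (lux_norm_dilation_le) settles that case.\<close>

lemma lux_norm_dilation_le_dil_norm:
  assumes "young \<Phi>" "l > 0" "f \<in> borel_measurable lebesgue" "lux_norm \<Phi> f < \<infinity>"
  shows "lux_norm \<Phi> (dilation l f) \<le> dil_norm \<Phi> l * lux_norm \<Phi> f"
proof (cases "lux_norm \<Phi> f = 0")
  case True
  then show ?thesis using lux_norm_dilation_le[OF assms(1-3)] by simp
next
  case False
  then obtain n where n: "n > 0" "lux_norm \<Phi> f = ennreal n"
    using assms(4) by (cases "lux_norm \<Phi> f" rule: ennreal_cases) (auto simp: le_less)
  define g where "g = (\<lambda>x. of_real (1 / n) * f x)"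
  have g: "lux_norm \<Phi> g \<le> 1"
    using lux_norm_cmult_le[of "1/n" \<Phi> f] n unfolding g_def
    by (simp flip: ennreal_mult)
  have "g \<in> borel_measurable lebesgue" unfolding g_def using assms(3) by measurable
  then have "g \<in> orlicz_space \<Phi>"
    using g by (intro orlicz_space_if_lux_norm_finite) (auto simp: le_less_trans)
  then have D: "lux_norm \<Phi> (dilation l g) \<le> dil_norm \<Phi> l"
    unfolding dil_norm_def orlicz_opnorm_def using g by (intro SUP_upper) auto
  have "dilation l f = (\<lambda>x. of_real n * dilation l g x)"
    using n by (auto simp: dilation_def g_def)
  then have "lux_norm \<Phi> (dilation l f) \<le> ennreal n * lux_norm \<Phi> (dilation l g)"
    using lux_norm_cmult_le[OF n(1)] by simp
  also have "\<dots> \<le> ennreal n * dil_norm \<Phi> l" using D by (rule mult_left_mono) simp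
  finally show ?thesis by (simp add: n mult.commute)
qed

lemma lux_norm_translate_le:
  assumes "young \<Phi>" "f \<in> borel_measurable lebesgue"
  shows "lux_norm \<Phi> (\<lambda>x. f (x + y)) \<le> lux_norm \<Phi> f"
proof -
  have "lux_norm \<Phi> (\<lambda>x. f (x + y)) \<le> ennreal 1 * lux_norm \<Phi> f"
  proof (rule lux_norm_le_cmult)
    fix s :: real assume s: "0 < s" "(\<integral>\<^sup>+x. \<Phi> (cmod (f x) / s) \<partial>lebesgue) \<le> 1"
    have "(\<integral>\<^sup>+x. \<Phi> (cmod (f x) / s) \<partial>lebesgue)
        = ennreal \<bar>1\<bar> * (\<integral>\<^sup>+x. \<Phi> (cmod (f (y + 1 * x)) / s) \<partial>lebesgue)"
      by (intro nn_integral_real_affine_lebesgue young_lebesgue_measurable assms) auto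
    then show "(\<integral>\<^sup>+x. \<Phi> (cmod (f (x + y)) / (1 * s)) \<partial>lebesgue) \<le> 1"
      using s by (simp add: add.commute)
  qed simp
  then show ?thesis by simp
qed

text \<open>A Young function grows at least linearly from any point where it is non-zero. If the norm of
  \<^term>\<open>h\<close> were too small, the modular would exceed 1 on the interval alone. What matters later is
  that \<^term>\<open>s0\<close> is uniform in \<^term>\<open>h\<close>.\<close>

lemma lux_norm_lower_bound:
  assumes "young \<Phi>" "c > 0" "\<delta> > 0"
  shows "\<exists>s0>0. \<forall>h. (\<forall>z\<in>{-\<delta>..\<delta>}. c \<le> cmod (h z)) \<longrightarrow> ennreal s0 \<le> lux_norm \<Phi> h"
proof -
  obtain x where x: "\<Phi> x \<noteq> 0" using assms(1) by (auto simp: young_def)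
  then have x0: "x \<noteq> 0" using assms(1) by (auto simp: young_def)
  obtain r where r: "r > 0" "ennreal r \<le> \<Phi> x"
  proof (cases "\<Phi> x" rule: ennreal_cases)
    case (real r)
    then show ?thesis using x that[of r] by (auto simp: le_less)
  next
    case top
    then show ?thesis using that[of 1] by simp
  qed
  \<comment> \<open>Then a function of size c on the interval has modular at least 2 for every s below s0.\<close>
  define k where "k = max 1 (1 / (\<delta> * r))"
  have k: "k \<ge> 1" "2 * \<delta> * (k * r) > 1"
  proof -
    have "1 / (\<delta> * r) \<le> k" by (simp add: k_def)
    then have "1 \<le> k * (\<delta> * r)" using assms(3) r by (simp add: field_simps)
    then show "2 * \<delta> * (k * r) > 1" by (simp add: algebra_simps)
  qed (simp add: k_def)
  have kx: "ennreal (k * r) \<le> \<Phi> (k * x)"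
  proof -
    have "\<Phi> (1 / k * (k * x)) \<le> ennreal (1 / k) * \<Phi> (k * x)"
      using k by (intro young_scale assms) auto
    then have "ennreal r \<le> ennreal (1 / k) * \<Phi> (k * x)" using r k by simp
    then have "ennreal k * ennreal r \<le> ennreal k * (ennreal (1 / k) * \<Phi> (k * x))"
      by (rule mult_left_mono) simp
    also have "\<dots> = \<Phi> (k * x)"
      using k by (simp add: mult.assoc[symmetric] ennreal_mult[symmetric])
    finally show ?thesis using k r by (simp add: ennreal_mult)
  qed
  define s0 where "s0 = c / (k * \<bar>x\<bar>)"
  have "s0 > 0" using k x0 assms by (simp add: s0_def)
  moreover have "ennreal s0 \<le> lux_norm \<Phi> h" if h: "\<forall>z\<in>{-\<delta>..\<delta>}. c \<le> cmod (h z)" for h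
    unfolding lux_norm_def
  proof (rule Inf_greatest, clarify)
    fix s :: real assume s: "0 < s" "(\<integral>\<^sup>+x. \<Phi> (cmod (h x) / s) \<partial>lebesgue) \<le> 1"
    show "ennreal s0 \<le> ennreal s"
    proof (rule ccontr)
      assume "\<not> ?thesis"
      then have "s < s0" using s by (simp add: ennreal_less_iff not_le)
      then have "k * \<bar>x\<bar> * s \<le> c" using k x0 by (simp add: s0_def field_simps)
      then have "\<bar>k * x\<bar> \<le> \<bar>c / s\<bar>" using s k assms by (simp add: abs_mult field_simps)
      then have big: "ennreal (k * r) \<le> \<Phi> (c / s)"
        using kx young_mono[OF assms(1)] order_trans by blast
      have "ennreal (k * r) * emeasure lebesgue {-\<delta>..\<delta>}
          = (\<integral>\<^sup>+z. ennreal (k * r) * indicator {-\<delta>..\<delta>} z \<partial>lebesgue)"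
        by (subst nn_integral_cmult_indicator) auto
      also have "\<dots> \<le> (\<integral>\<^sup>+z. \<Phi> (cmod (h z) / s) \<partial>lebesgue)"
      proof (rule nn_integral_mono)
        fix z
        show "ennreal (k * r) * indicator {-\<delta>..\<delta>} z \<le> \<Phi> (cmod (h z) / s)"
        proof (cases "z \<in> {-\<delta>..\<delta>}")
          case True
          then have "\<bar>c / s\<bar> \<le> \<bar>cmod (h z) / s\<bar>"
            using h s assms by (auto simp: divide_right_mono)
          then show ?thesis using True order_trans[OF big young_mono[OF assms(1)]] by simp
        qed simp
      qed
      also have "\<dots> \<le> 1" by fact
      finally have "ennreal (k * r * (2 * \<delta>)) \<le> 1"
        using assms k r by (simp add: ennreal_mult)
      then show False using k by (simp add: algebra_simps)
    qed
  qed
  ultimately show ?thesis by blast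
qed

section \<open>The Fejer kernel\<close>

text \<open>The value at 0 is 0 by the convention for division; a single point affects no integral.\<close>

definition fejer :: "real \<Rightarrow> real" where
  "fejer x = (sin (pi * x) / x)\<^sup>2"

definition fejer_mass :: real where
  "fejer_mass = (LINT x|lborel. fejer x)"

definition tri :: "real \<Rightarrow> real" where
  "tri x = max 0 (1 - \<bar>x\<bar>)"

lemma fejer_measurable [measurable]: "fejer \<in> borel_measurable borel"
  unfolding fejer_def by measurable

lemma tri_continuous: "continuous_on UNIV tri"
  unfolding tri_def by (intro continuous_intros)

lemma tri_measurable [measurable]: "tri \<in> borel_measurable borel"
  by (rule borel_measurable_continuous_onI[OF tri_continuous])

lemma tri_bounds: "0 \<le> tri x" "tri x \<le> 1"
  by (auto simp: tri_def)

lemma tri_eq_0: "\<bar>x\<bar> > 1 \<Longrightarrow> tri x = 0"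
  by (auto simp: tri_def)

lemma tri_integrable: "integrable lborel tri"
proof (rule Bochner_Integration.integrable_bound)
  show "integrable lborel (indicator {-1..1} :: real \<Rightarrow> real)" by simp
  show "AE x in lborel. norm (tri x) \<le> norm (indicator {-1..1} x :: real)"
    by (auto simp: tri_def indicator_def)
qed simp

lemma integrable_lborel_inverse_1_plus_square: "integrable lborel (\<lambda>x::real. inverse (1 + x\<^sup>2))"
  using integrable_inverse_1_plus_square by (simp add: set_integrable_def einterval_def)

text \<open>The comparison with the Cauchy density gives integrability, and membership in every Orlicz
  space.\<close>

lemma fejer_bound: "0 \<le> fejer x" "fejer x \<le> (1 + pi\<^sup>2) * inverse (1 + x\<^sup>2)"
proof -
  show "0 \<le> fejer x" by (simp add: fejer_def)
  have 1: "fejer x \<le> pi\<^sup>2"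
  proof -
    have "\<bar>sin (pi * x) / x\<bar> \<le> pi"
      using abs_sin_x_le_abs_x[of "pi * x"] by (cases "x = 0") (auto simp: abs_mult field_simps)
    then show ?thesis unfolding fejer_def by (rule power2_le_iff_abs_le[THEN iffD2, rotated]) simp
  qed
  have 2: "x\<^sup>2 * fejer x \<le> 1"
    by (cases "x = 0") (auto simp: fejer_def power_divide abs_square_le_1)
  have "(1 + x\<^sup>2) * fejer x \<le> 1 + pi\<^sup>2" using 1 2 by (simp add: algebra_simps)
  moreover have "1 + x\<^sup>2 > 0" by (simp add: add_pos_nonneg)
  ultimately show "fejer x \<le> (1 + pi\<^sup>2) * inverse (1 + x\<^sup>2)" by (simp add: field_simps)
qed

lemma fejer_integrable: "integrable lborel fejer"
proof (rule Bochner_Integration.integrable_bound)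
  show "integrable lborel (\<lambda>x::real. (1 + pi\<^sup>2) * inverse (1 + x\<^sup>2))"
    using integrable_lborel_inverse_1_plus_square by (rule integrable_mult_right)
  show "AE x in lborel. norm (fejer x) \<le> norm ((1 + pi\<^sup>2) * inverse (1 + x\<^sup>2))"
    using fejer_bound by (intro AE_I2) (simp add: abs_mult)
qed simp

lemma fejer_mass_pos: "fejer_mass > 0"
proof -
  have "fejer_mass \<noteq> 0"
  proof
    assume "fejer_mass = 0"
    then have "AE x in lborel. fejer x = 0"
      using integral_nonneg_eq_0_iff_AE[OF fejer_integrable] fejer_bound(1)
      by (simp add: fejer_mass_def)
    then have "AE x in lborel. x \<notin> {0<..<1::real}"
    proof eventually_elim
      case (elim x)
      have "sin (pi * x) > 0" if "0 < x" "x < 1" using that by (intro sin_gt_zero) auto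
      then show ?case using elim by (fastforce simp: fejer_def)
    qed
    then have "emeasure lborel {0<..<1::real} = 0"
      by (subst (asm) AE_iff_measurable[of "{0<..<1}"]) auto
    then show False by simp
  qed
  moreover have "fejer_mass \<ge> 0" unfolding fejer_mass_def by (simp add: fejer_bound)
  ultimately show ?thesis by simp
qed

text \<open>For \<^term>\<open>a \<noteq> (0::real)\<close> the integrand is a rescaled \<^const>\<open>fejer\<close>, so the integral is linear in
  \<^term>\<open>\<bar>a::real\<bar>\<close>.\<close>

lemma sin_square_quotient_integral:
  "integrable lborel (\<lambda>x. (sin (a * (pi * x)) / x)\<^sup>2)"
  "(LINT x|lborel. (sin (a * (pi * x)) / x)\<^sup>2) = \<bar>a\<bar> * fejer_mass"
proof -
  have eq: "(sin (a * (pi * x)) / x)\<^sup>2 = a\<^sup>2 * fejer (0 + a * x)" if "a \<noteq> 0" for x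
    using that by (simp add: fejer_def power_divide power_mult_distrib mult_ac)
  show "integrable lborel (\<lambda>x. (sin (a * (pi * x)) / x)\<^sup>2)"
  proof (cases "a = 0")
    case False
    then show ?thesis
      unfolding eq[OF False]
      by (intro integrable_mult_right lborel_integrable_real_affine fejer_integrable)
  qed simp
  show "(LINT x|lborel. (sin (a * (pi * x)) / x)\<^sup>2) = \<bar>a\<bar> * fejer_mass"
  proof (cases "a = 0")
    case False
    have "\<bar>a\<bar> * fejer_mass = \<bar>a\<bar> * (\<bar>a\<bar> * (LINT x|lborel. fejer (0 + a * x)))"
      unfolding fejer_mass_def by (subst lborel_integral_real_affine[OF False, of _ 0]) simp
    also have "\<dots> = a\<^sup>2 * (LINT x|lborel. fejer (0 + a * x))"
      by (simp add: power2_eq_square mult.assoc[symmetric])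
    finally show ?thesis unfolding eq[OF False] by simp
  qed simp
qed

lemma sin_squared_mult_cos:
  "2 * ((sin A)\<^sup>2 * cos (2 * B)) = (sin (A + B))\<^sup>2 + (sin (A - B))\<^sup>2 - 2 * (sin (B::real))\<^sup>2"
proof -
  have "(cos A)\<^sup>2 = 1 - (sin A)\<^sup>2" "(cos B)\<^sup>2 = 1 - (sin B)\<^sup>2" by (simp_all add: cos_squared_eq)
  then show ?thesis
    unfolding cos_double_sin sin_add sin_diff by algebra
qed

text \<open>The product of the kernel with a cosine is a combination of squares of sines, each of which
  integrates to a multiple of the absolute value of its frequency. Half of their second difference
  is the tent function. This shows that the transform has compact support without Fourier inversion, and
  without the value of \<^const>\<open>fejer_mass\<close>.\<close>

lemma fejer_cos_integral: "(LINT x|lborel. fejer x * cos (2 * (\<xi> * (pi * x)))) = fejer_mass * tri \<xi>"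
proof -
  have "fejer x * cos (2 * (\<xi> * (pi * x)))
     = ((sin ((1 + \<xi>) * (pi * x)) / x)\<^sup>2 + (sin ((1 - \<xi>) * (pi * x)) / x)\<^sup>2
        - 2 * (sin (\<xi> * (pi * x)) / x)\<^sup>2) / 2" for x
  proof -
    have "fejer x * cos (2 * (\<xi> * (pi * x)))
        = 2 * ((sin (pi * x))\<^sup>2 * cos (2 * (\<xi> * (pi * x)))) / x\<^sup>2 / 2"
      by (simp add: fejer_def power_divide)
    also note sin_squared_mult_cos
    finally show ?thesis
      by (simp add: power_divide add_divide_distrib diff_divide_distrib distrib_right left_diff_distrib)
  qed
  then have "(LINT x|lborel. fejer x * cos (2 * (\<xi> * (pi * x))))
     = (LINT x|lborel. ((sin ((1 + \<xi>) * (pi * x)) / x)\<^sup>2 + (sin ((1 - \<xi>) * (pi * x)) / x)\<^sup>2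
        - 2 * (sin (\<xi> * (pi * x)) / x)\<^sup>2) / 2)"
    by (intro Bochner_Integration.integral_cong refl)
  also have "\<dots> = (\<bar>1 + \<xi>\<bar> * fejer_mass + \<bar>1 - \<xi>\<bar> * fejer_mass - 2 * (\<bar>\<xi>\<bar> * fejer_mass)) / 2"
    by (simp add: sin_square_quotient_integral)
  also have "\<dots> = fejer_mass * ((\<bar>1 + \<xi>\<bar> + \<bar>1 - \<xi>\<bar> - 2 * \<bar>\<xi>\<bar>) / 2)"
    by (simp add: algebra_simps)
  also have "(\<bar>1 + \<xi>\<bar> + \<bar>1 - \<xi>\<bar> - 2 * \<bar>\<xi>\<bar>) / 2 = tri \<xi>"
    by (auto simp: tri_def max_def abs_if)
  finally show ?thesis .
qed

lemma fejer_sin_integral: "(LINT x|lborel. fejer x * sin (2 * (\<xi> * (pi * x)))) = 0"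
proof -
  have "(LINT x|lborel. fejer x * sin (2 * (\<xi> * (pi * x))))
      = - (LINT x|lborel. fejer x * sin (2 * (\<xi> * (pi * x))))"
    by (subst lborel_integral_real_affine[of "-1" _ 0]) (simp_all add: fejer_def)
  then show ?thesis by simp
qed

lemma fejer_fourier:
  "(LINT x|lborel. of_real (fejer x) * cis (- 2 * pi * x * \<xi>)) = complex_of_real (fejer_mass * tri \<xi>)"
proof -
  have c: "integrable lborel (\<lambda>x. fejer x * cos (2 * (\<xi> * (pi * x))))"
    by (rule Bochner_Integration.integrable_bound[OF fejer_integrable])
      (auto simp: abs_mult intro!: mult_left_le)
  have s: "integrable lborel (\<lambda>x. fejer x * sin (2 * (\<xi> * (pi * x))))"
    by (rule Bochner_Integration.integrable_bound[OF fejer_integrable])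
      (auto simp: abs_mult intro!: mult_left_le)
  have "(LINT x|lborel. of_real (fejer x) * cis (- 2 * pi * x * \<xi>))
      = (LINT x|lborel. complex_of_real (fejer x * cos (2 * (\<xi> * (pi * x))))
                        - \<i> * complex_of_real (fejer x * sin (2 * (\<xi> * (pi * x)))))"
    by (intro Bochner_Integration.integral_cong) (auto simp: complex_eq_iff mult_ac)
  also have "\<dots> = complex_of_real (fejer_mass * tri \<xi>)"
  proof (subst Bochner_Integration.integral_diff)
    show "integrable lborel (\<lambda>x. complex_of_real (fejer x * cos (2 * (\<xi> * (pi * x)))))"
      using c by (rule integrable_of_real)
    show "integrable lborel (\<lambda>x. \<i> * complex_of_real (fejer x * sin (2 * (\<xi> * (pi * x)))))"
      using s by (intro integrable_mult_right integrable_of_real)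
    show "(LINT x|lborel. complex_of_real (fejer x * cos (2 * (\<xi> * (pi * x)))))
        - (LINT x|lborel. \<i> * complex_of_real (fejer x * sin (2 * (\<xi> * (pi * x)))))
        = complex_of_real (fejer_mass * tri \<xi>)"
      unfolding integral_mult_right_zero integral_complex_of_real
        fejer_cos_integral fejer_sin_integral by simp
  qed
  finally show ?thesis .
qed

section \<open>Integrals depending on a parameter\<close>

lemma integral_param_continuous:
  fixes K :: "'q::{first_countable_topology,t2_space} \<Rightarrow> 'p \<Rightarrow> 'b::{banach,second_countable_topology}"
  assumes "\<And>q. q \<in> S \<Longrightarrow> K q \<in> borel_measurable N" "q0 \<in> S" "integrable N w"
    and "\<And>q p. q \<in> S \<Longrightarrow> norm (K q p) \<le> w p"
    and "\<And>p. continuous (at q0 within S) (\<lambda>q. K q p)"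
  shows "continuous (at q0 within S) (\<lambda>q. LINT p|N. K q p)"
proof (rule continuous_within_sequentiallyI)
  fix u :: "nat \<Rightarrow> 'q" assume u: "u \<longlonglongrightarrow> q0" "\<forall>n. u n \<in> S"
  show "(\<lambda>n. LINT p|N. K (u n) p) \<longlonglongrightarrow> (LINT p|N. K q0 p)"
  proof (rule integral_dominated_convergence[OF _ _ assms(3)])
    show "AE p in N. (\<lambda>n. K (u n) p) \<longlonglongrightarrow> K q0 p"
      using assms(5) u unfolding continuous_within_sequentially comp_def by (intro AE_I2) blast
  qed (use u assms in auto)
qed

lemma integrable_product_real:
  fixes f g :: "real \<Rightarrow> real"
  assumes "integrable lborel f" "integrable lborel g"
  shows "integrable (lborel \<Otimes>\<^sub>M lborel) (\<lambda>p. f (fst p) * g (snd p))"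
proof (rule lborel_pair.Fubini_integrable)
  have [measurable]: "f \<in> borel_measurable borel" "g \<in> borel_measurable borel"
    using assms by auto
  show "(\<lambda>p. f (fst p) * g (snd p)) \<in> borel_measurable (lborel \<Otimes>\<^sub>M lborel)" by measurable
  show "integrable lborel (\<lambda>x. LINT y|lborel. norm (f (fst (x, y)) * g (snd (x, y))))"
    using assms by (simp add: abs_mult)
  show "AE x in lborel. integrable lborel (\<lambda>y. f (fst (x, y)) * g (snd (x, y)))"
    using assms by simp
qed

text \<open>By dominated convergence on the product space the integral depends continuously on
  \<^term>\<open>(h, z)\<close> at the origin. A non-zero value there therefore
  stays away from 0 on a whole neighbourhood. Both regimes of dilation are instances, with \<^term>\<open>h\<close>
  the dilation parameter or its inverse, and \<^term>\<open>z\<close> the rescaled space variable.\<close>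

lemma iterated_integral_bounded_below:
  fixes K :: "real \<Rightarrow> real \<Rightarrow> real \<Rightarrow> real \<Rightarrow> complex"
  assumes meas: "\<And>h z. (\<lambda>p. K h z (fst p) (snd p)) \<in> borel_measurable (lborel \<Otimes>\<^sub>M lborel)"
    and f: "integrable lborel f" and g: "integrable lborel g"
    and bound: "\<And>h z v u. \<bar>h\<bar> \<le> 1 \<Longrightarrow> cmod (K h z v u) \<le> f v * g u"
    and cont: "\<And>v u. continuous_on UNIV (\<lambda>q. K (fst q) (snd q) v u)"
    and nonzero: "(LINT v|lborel. LINT u|lborel. K 0 0 v u) \<noteq> 0"
  shows "\<exists>c>0. \<exists>\<delta>>0. \<forall>h z. \<bar>h\<bar> \<le> \<delta> \<longrightarrow> \<bar>z\<bar> \<le> \<delta> \<longrightarrow>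
           c \<le> cmod (LINT v|lborel. LINT u|lborel. K h z v u)"
proof -
  define S :: "(real \<times> real) set" where "S = {q. \<bar>fst q\<bar> \<le> 1}"
  define G where "G q = (LINT p|(lborel \<Otimes>\<^sub>M lborel). K (fst q) (snd q) (fst p) (snd p))" for q
  have G: "G q = (LINT v|lborel. LINT u|lborel. K (fst q) (snd q) v u)" if "q \<in> S" for q
  proof -
    have "integrable (lborel \<Otimes>\<^sub>M lborel) (\<lambda>p. K (fst q) (snd q) (fst p) (snd p))"
      using that bound
      by (intro Bochner_Integration.integrable_bound[OF integrable_product_real[OF f g] meas] AE_I2)
        (auto simp: S_def intro: order_trans[OF _ abs_ge_self])
    from lborel_pair.integral_fst'[OF this] show ?thesis by (simp add: G_def)
  qed
  have "continuous (at (0, 0) within S) G"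
    unfolding G_def
  proof (rule integral_param_continuous[OF meas _ integrable_product_real[OF f g]])
    fix p :: "real \<times> real"
    show "continuous (at (0, 0) within S) (\<lambda>q. K (fst q) (snd q) (fst p) (snd p))"
      using continuous_on_subset[OF cont subset_UNIV, of S]
      by (auto simp: continuous_on_eq_continuous_within S_def)
  qed (use bound in \<open>auto simp: S_def\<close>)
  then have "((\<lambda>q. cmod (G q)) \<longlongrightarrow> cmod (G (0, 0))) (at (0, 0) within S)"
    unfolding continuous_within by (rule tendsto_norm)
  moreover define c where "c = cmod (G (0, 0)) / 2"
  have "G (0, 0) \<noteq> 0" using nonzero by (simp add: G S_def)
  then have c: "c > 0" "c < cmod (G (0, 0))" by (auto simp: c_def)
  ultimately have "\<forall>\<^sub>F q in at (0, 0) within S. c < cmod (G q)"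
    using order_tendstoD(1) by blast
  then obtain d where d: "d > 0" "\<And>q. q \<in> S \<Longrightarrow> q \<noteq> (0, 0) \<Longrightarrow> dist q (0, 0) < d \<Longrightarrow> c < cmod (G q)"
    unfolding eventually_at by blast
  \<comment> \<open>Two coordinates of size at most one third of the radius stay strictly inside the ball.\<close>
  define \<delta> where "\<delta> = min 1 (d / 3)"
  have "\<delta> > 0" using d by (simp add: \<delta>_def)
  moreover have "c \<le> cmod (LINT v|lborel. LINT u|lborel. K h z v u)" if "\<bar>h\<bar> \<le> \<delta>" "\<bar>z\<bar> \<le> \<delta>" for h z
  proof -
    have S: "(h, z) \<in> S" using that by (simp add: S_def \<delta>_def)
    have "norm (h, z) \<le> \<bar>h\<bar> + \<bar>z\<bar>" using norm_Pair_le[of h z] by simp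
    also have "\<dots> < d" using that d by (auto simp: \<delta>_def)
    finally have "dist (h, z) (0, 0) < d" by (metis dist_0_norm dist_commute zero_prod_def)
    then have "c \<le> cmod (G (h, z))" using d(2)[OF S] c by force
    then show ?thesis using G[OF S] by simp
  qed
  ultimately show ?thesis using c by blast
qed

lemma continuous_locally_bounded:
  fixes M :: "real \<Rightarrow> complex"
  assumes "continuous_on UNIV M"
  shows "\<exists>B\<ge>0. \<forall>x. \<bar>x - a\<bar> \<le> r \<longrightarrow> cmod (M x) \<le> B"
proof -
  have "bounded (M ` cball a r)"
    using assms by (intro compact_imp_bounded compact_continuous_image continuous_on_subset[OF assms]) auto
  then obtain B where "\<forall>x\<in>cball a r. cmod (M x) \<le> B" unfolding bounded_iff by blast
  then show ?thesis
    by (intro exI[of _ "max 0 B"]) (auto simp: dist_real_def abs_minus_commute le_max_iff_disj)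
qed

text \<open>The inner translation may depend on the outer variable: the frequency substitutions used
  later centre one frequency at a fixed point or at the other frequency.\<close>

lemma iterated_integral_affine:
  fixes G :: "real \<Rightarrow> real \<Rightarrow> complex"
  assumes "c \<noteq> 0" "d \<noteq> 0"
  shows "(LINT \<eta>|lborel. LINT \<xi>|lborel. G \<eta> \<xi>)
       = \<bar>c * d\<bar> *\<^sub>R (LINT v|lborel. LINT u|lborel. G (c * v) (t v + d * u))"
proof -
  have "(LINT \<eta>|lborel. LINT \<xi>|lborel. G \<eta> \<xi>)
      = \<bar>c\<bar> *\<^sub>R (LINT v|lborel. LINT \<xi>|lborel. G (0 + c * v) \<xi>)"
    by (rule lborel_integral_real_affine[OF assms(1)])
  also have "(LINT v|lborel. LINT \<xi>|lborel. G (0 + c * v) \<xi>)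
      = (LINT v|lborel. \<bar>d\<bar> *\<^sub>R (LINT u|lborel. G (c * v) (t v + d * u)))"
    using lborel_integral_real_affine[OF assms(2)] by (intro Bochner_Integration.integral_cong) auto
  finally show ?thesis by (simp add: abs_mult)
qed

lemma iterated_integral_lebesgue:
  fixes G :: "real \<Rightarrow> real \<Rightarrow> complex"
  assumes [measurable]: "(\<lambda>p. G (fst p) (snd p)) \<in> borel_measurable (borel \<Otimes>\<^sub>M borel)"
  shows "(LINT \<eta>|lebesgue. LINT \<xi>|lebesgue. G \<eta> \<xi>) = (LINT \<eta>|lborel. LINT \<xi>|lborel. G \<eta> \<xi>)"
proof -
  have G [measurable]: "(\<lambda>(\<eta>, \<xi>). G \<eta> \<xi>) \<in> borel_measurable (borel \<Otimes>\<^sub>M borel)"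
    using assms by (simp add: case_prod_beta')
  have "(LINT \<xi>|lebesgue. G \<eta> \<xi>) = (LINT \<xi>|lborel. G \<eta> \<xi>)" for \<eta>
    by (rule integral_completion) measurable
  moreover have "(LINT \<eta>|lebesgue. LINT \<xi>|lborel. G \<eta> \<xi>) = (LINT \<eta>|lborel. LINT \<xi>|lborel. G \<eta> \<xi>)"
    by (rule integral_completion) measurable
  ultimately show ?thesis by simp
qed

lemma integral_tri_power_pos:
  assumes "0 < n"
  shows "integrable lborel (\<lambda>x. tri x ^ n)" "(LINT x|lborel. tri x ^ n) > 0"
proof -
  show *: "integrable lborel (\<lambda>x. tri x ^ n)"
    using power_decreasing[of 1 n "tri x" for x] assms tri_bounds
    by (intro Bochner_Integration.integrable_bound[OF tri_integrable] AE_I2) auto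
  have step: "integrable lborel (\<lambda>x. (1 / 2) ^ n * indicator {- 1 / 2..1 / 2 :: real} x :: real)"
    by (intro integrable_mult_right integrable_real_indicator) auto
  have "0 < (LINT x|lborel. (1 / 2) ^ n * indicator {- 1 / 2..1 / 2 :: real} x :: real)" by simp
  also have "\<dots> \<le> (LINT x|lborel. tri x ^ n)"
    by (intro integral_mono * step) (auto simp: indicator_def tri_def intro!: power_mono)
  finally show "(LINT x|lborel. tri x ^ n) > 0" .
qed

section \<open>Modulated, translated and dilated Fejer kernels\<close>

text \<open>Modulation and translation cost nothing in any Luxemburg norm. On the Fourier side they move
  the tent to \<^term>\<open>a\<close> and multiply it by a character.\<close>

definition wave :: "real \<Rightarrow> real \<Rightarrow> real \<Rightarrow> real \<Rightarrow> complex" where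
  "wave a y l x = cis (2 * pi * a * x) * of_real (fejer (l * (x + y)))"

lemma wave_measurable [measurable]: "wave a y l \<in> borel_measurable borel"
  unfolding wave_def cis_conv_exp by measurable

lemma wave_integrable:
  assumes "l > 0"
  shows "integrable lborel (wave a y l)"
proof (rule Bochner_Integration.integrable_bound)
  show "integrable lborel (\<lambda>x. fejer (l * y + l * x))"
    using assms by (intro lborel_integrable_real_affine fejer_integrable) auto
  show "AE x in lborel. norm (wave a y l x) \<le> norm (fejer (l * y + l * x))"
    by (simp add: wave_def norm_mult algebra_simps)
qed simp

lemma fourier_wave:
  assumes "l > 0"
  shows "fourier (wave a y l) \<xi>
       = cis (2 * pi * y * (\<xi> - a)) * of_real (fejer_mass / l * tri ((\<xi> - a) / l))"
proof -
  have "fourier (wave a y l) \<xi> = (LINT x|lebesgue. wave a y l x * cis (- 2 * pi * x * \<xi>))"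
    by (simp add: fourier_def cis_conv_exp mult_ac)
  also have "\<dots> = (LINT x|lborel. wave a y l x * cis (- 2 * pi * x * \<xi>))"
    by (rule integral_completion) (unfold cis_conv_exp, measurable)
  also have "\<dots> = \<bar>1 / l\<bar> *\<^sub>R (LINT x|lborel. wave a y l (- y + 1 / l * x) * cis (- 2 * pi * (- y + 1 / l * x) * \<xi>))"
    using assms by (intro lborel_integral_real_affine) simp
  also have "(\<lambda>x. wave a y l (- y + 1 / l * x) * cis (- 2 * pi * (- y + 1 / l * x) * \<xi>))
      = (\<lambda>x. cis (2 * pi * y * (\<xi> - a)) * (of_real (fejer x) * cis (- 2 * pi * x * ((\<xi> - a) / l))))"
  proof
    fix x
    have "cis (2 * pi * a * (- y + 1 / l * x)) * cis (- 2 * pi * (- y + 1 / l * x) * \<xi>)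
        = cis (2 * pi * y * (\<xi> - a)) * cis (- 2 * pi * x * ((\<xi> - a) / l))"
      unfolding cis_mult by (rule arg_cong[of _ _ cis]) (simp add: algebra_simps diff_divide_distrib)
    moreover have "l * (- y + 1 / l * x + y) = x" using assms by simp
    ultimately show "wave a y l (- y + 1 / l * x) * cis (- 2 * pi * (- y + 1 / l * x) * \<xi>)
      = cis (2 * pi * y * (\<xi> - a)) * (of_real (fejer x) * cis (- 2 * pi * x * ((\<xi> - a) / l)))"
      unfolding wave_def by (simp only: mult_ac)
  qed
  finally show ?thesis
    using assms unfolding integral_mult_right_zero fejer_fourier
    by (simp add: scaleR_conv_of_real mult_ac)
qed

lemma wave_paley_wiener:
  assumes "l > 0"
  shows "wave a y l \<in> paley_wiener"
proof -
  have "{\<xi>. fourier (wave a y l) \<xi> \<noteq> 0} \<subseteq> cball a l"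
  proof (clarify, rule ccontr)
    fix \<xi> assume nz: "fourier (wave a y l) \<xi> \<noteq> 0" and "\<xi> \<notin> cball a l"
    then have "\<bar>(\<xi> - a) / l\<bar> > 1" using assms by (auto simp: dist_real_def abs_minus_commute)
    then show False using nz tri_eq_0 by (simp add: fourier_wave[OF assms])
  qed
  then have "compact (closure {\<xi>. fourier (wave a y l) \<xi> \<noteq> 0})"
    using bounded_cball bounded_subset by (simp add: compact_closure) blast
  then show ?thesis
    unfolding paley_wiener_def using wave_integrable[OF assms] by (simp add: integrable_completion)
qed

text \<open>Convexity bounds the modular by a multiple of the integral of the Cauchy density.\<close>

lemma fejer_orlicz:
  assumes "young \<Phi>"
  shows "(\<lambda>x. complex_of_real (fejer x)) \<in> orlicz_space \<Phi>"
proof -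
  obtain x0 where x0: "x0 > 0" "\<Phi> x0 < \<infinity>" using assms by (auto simp: young_def)
  define s where "s = (1 + pi\<^sup>2) / x0"
  have s: "s > 0" using x0 by (simp add: s_def add_pos_nonneg)
  have "(\<integral>\<^sup>+x. \<Phi> (cmod (complex_of_real (fejer x)) / s) \<partial>lebesgue)
      = (\<integral>\<^sup>+x. \<Phi> (fejer x / s) \<partial>lborel)"
    by (simp add: nn_integral_completion fejer_bound)
  also have "\<dots> \<le> (\<integral>\<^sup>+x. ennreal (inverse (1 + x\<^sup>2)) * \<Phi> x0 \<partial>lborel)"
  proof (rule nn_integral_mono)
    fix x :: real
    have pos: "1 + x\<^sup>2 > 0" by (simp add: add_pos_nonneg)
    have "fejer x / s \<le> (1 + pi\<^sup>2) * inverse (1 + x\<^sup>2) / s"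
      using fejer_bound s by (intro divide_right_mono) auto
    also have "\<dots> = inverse (1 + x\<^sup>2) * x0"
      unfolding s_def using x0 by (simp add: add_pos_nonneg less_imp_neq[symmetric])
    finally have "\<Phi> (fejer x / s) \<le> \<Phi> (inverse (1 + x\<^sup>2) * x0)"
      using fejer_bound(1)[of x] s x0 by (intro young_mono[OF assms]) (auto simp: abs_mult)
    also have "\<dots> \<le> ennreal (inverse (1 + x\<^sup>2)) * \<Phi> x0"
      using pos by (intro young_scale[OF assms]) (auto simp: inverse_le_1_iff)
    finally show "\<Phi> (fejer x / s) \<le> ennreal (inverse (1 + x\<^sup>2)) * \<Phi> x0" .
  qed
  also have "\<dots> = (\<integral>\<^sup>+x. ennreal (inverse (1 + x\<^sup>2)) \<partial>lborel) * \<Phi> x0"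
    by (rule nn_integral_multc) simp
  also have "\<dots> < \<infinity>"
    using integrable_lborel_inverse_1_plus_square x0
    by (simp add: integrable_iff_bounded ennreal_mult_less_top add_nonneg_nonneg)
  finally show ?thesis
    unfolding orlicz_space_def using s by (auto intro: measurable_completion)
qed

lemma lux_norm_wave_le_dilation:
  assumes "young \<Phi>" "l > 0"
  shows "lux_norm \<Phi> (wave a y l) \<le> lux_norm \<Phi> (dilation l (\<lambda>x. of_real (fejer x)))"
proof -
  let ?F = "\<lambda>x. complex_of_real (fejer x)"
  have F: "?F \<in> borel_measurable lebesgue" by (rule measurable_completion) measurable
  have "lux_norm \<Phi> (wave a y l) \<le> lux_norm \<Phi> (\<lambda>x. dilation l ?F (x + y))"
    by (intro lux_norm_mono assms) (simp add: wave_def dilation_def norm_mult)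
  also have "\<dots> \<le> lux_norm \<Phi> (dilation l ?F)"
    using assms F by (intro lux_norm_translate_le dilation_measurable) auto
  finally show ?thesis .
qed

lemma lux_norm_wave_le:
  assumes "young \<Phi>" "l > 0"
  shows "lux_norm \<Phi> (wave a y l) \<le> dil_norm \<Phi> l * lux_norm \<Phi> (\<lambda>x. of_real (fejer x))"
  using assms
  by (intro order_trans[OF lux_norm_wave_le_dilation] lux_norm_dilation_le_dil_norm
      lux_norm_finite fejer_orlicz) (auto intro: measurable_completion)

lemma lux_norm_wave_finite:
  assumes "young \<Phi>" "l > 0"
  shows "lux_norm \<Phi> (wave a y l) < \<infinity>"
proof -
  let ?F = "\<lambda>x. complex_of_real (fejer x)"
  have "lux_norm \<Phi> (wave a y l) \<le> lux_norm \<Phi> (dilation l ?F)"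
    by (rule lux_norm_wave_le_dilation[OF assms])
  also have "\<dots> \<le> ennreal (max 1 (1 / l)) * lux_norm \<Phi> ?F"
    using assms by (intro lux_norm_dilation_le) (auto intro: measurable_completion)
  also have "\<dots> < \<infinity>"
    using lux_norm_finite[OF assms(1) fejer_orlicz[OF assms(1)]] by (simp add: ennreal_mult_less_top)
  finally show ?thesis .
qed

section \<open>Bilinear multipliers and dilations\<close>

lemma fourier_wave_measurable:
  "l > 0 \<Longrightarrow> fourier (wave a y l) \<in> borel_measurable borel"
  by (subst fourier_wave[THEN ext]) (auto simp: cis_conv_exp)

lemma bilinear_op_lborel:
  assumes [measurable]: "fourier f \<in> borel_measurable borel" "fourier g \<in> borel_measurable borel"
    "M \<in> borel_measurable borel"
  shows "bilinear_op M f g x = (LINT \<eta>|lborel. LINT \<xi>|lborel.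
           fourier f \<xi> * fourier g \<eta> * M (\<xi> - \<eta>) * cis (2 * pi * (\<xi> + \<eta>) * x))"
proof -
  have "bilinear_op M f g x = (LINT \<eta>|lebesgue. LINT \<xi>|lebesgue.
           fourier f \<xi> * fourier g \<eta> * M (\<xi> - \<eta>) * cis (2 * pi * (\<xi> + \<eta>) * x))"
    by (simp add: bilinear_op_def cis_conv_exp mult_ac)
  also have "\<dots> = (LINT \<eta>|lborel. LINT \<xi>|lborel.
           fourier f \<xi> * fourier g \<eta> * M (\<xi> - \<eta>) * cis (2 * pi * (\<xi> + \<eta>) * x))"
    by (rule iterated_integral_lebesgue) (unfold cis_conv_exp, measurable)
  finally show ?thesis .
qed

lemma bilinear_op_measurable:
  assumes [measurable]: "fourier f \<in> borel_measurable borel" "fourier g \<in> borel_measurable borel"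
    "M \<in> borel_measurable borel"
  shows "bilinear_op M f g \<in> borel_measurable lebesgue"
proof -
  have "(\<lambda>x. LINT \<eta>|lborel. LINT \<xi>|lborel.
           fourier f \<xi> * fourier g \<eta> * M (\<xi> - \<eta>) * cis (2 * pi * (\<xi> + \<eta>) * x))
        \<in> borel_measurable borel"
    unfolding cis_conv_exp by measurable
  then show ?thesis
    by (subst bilinear_op_lborel[OF assms, THEN ext]) (simp add: measurable_completion)
qed

text \<open>The product of dilation norms arises from the estimate for the multiplier, applied to two
  functions of scale \<^term>\<open>l\<close>, followed by a dilation that undoes the scale. So it is bounded below
  as soon as the rescaled output is bounded below on a fixed interval. The weight \<^term>\<open>\<rho>\<close> is 1 for
  small dilations and \<^term>\<open>l\<close> for large ones.\<close>

lemma multiplier_scaling: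
  assumes young: "young \<Phi>1" "young \<Phi>2" "young \<Phi>3"
    and M: "M \<in> bilinear_multipliers \<Phi>1 \<Phi>2 \<Phi>3" "M \<in> borel_measurable borel"
    and c: "c > 0" and \<delta>: "\<delta> > 0"
  shows "\<exists>\<epsilon>>0. \<forall>l>0. \<forall>\<rho>>0. \<forall>a b y y'.
     (\<forall>z\<in>{-\<delta>..\<delta>}. c \<le> \<rho> * cmod (bilinear_op M (wave a y l) (wave b y' l) (1 / l * z))) \<longrightarrow>
     \<epsilon> \<le> ennreal \<rho> * dil_norm \<Phi>1 l * dil_norm \<Phi>2 l * dil_norm \<Phi>3 (1 / l)"
proof -
  let ?F = "\<lambda>x. complex_of_real (fejer x)"
  obtain C where C: "C > 0" "\<And>f g. f \<in> paley_wiener \<Longrightarrow> g \<in> paley_wiener \<Longrightarrow>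
      lux_norm \<Phi>3 (bilinear_op M f g) \<le> ennreal C * lux_norm \<Phi>1 f * lux_norm \<Phi>2 g"
    using M(1) unfolding bilinear_multipliers_def by blast
  obtain s0 where s0: "s0 > 0"
    "\<And>h. (\<forall>z\<in>{-\<delta>..\<delta>}. c \<le> cmod (h z)) \<Longrightarrow> ennreal s0 \<le> lux_norm \<Phi>3 h"
    using lux_norm_lower_bound[OF young(3) c \<delta>] by blast
  obtain r1 where r1: "lux_norm \<Phi>1 ?F = ennreal r1" "r1 \<ge> 0"
    using lux_norm_finite[OF young(1) fejer_orlicz[OF young(1)]] by (auto simp: less_top_ennreal)
  obtain r2 where r2: "lux_norm \<Phi>2 ?F = ennreal r2" "r2 \<ge> 0"
    using lux_norm_finite[OF young(2) fejer_orlicz[OF young(2)]] by (auto simp: less_top_ennreal)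
  \<comment> \<open>The summand 1 keeps the divisor positive when one of the kernel norms is 0.\<close>
  define k where "k = C * r1 * r2 + 1"
  have k: "k > 0" "C * r1 * r2 \<le> k" using C r1 r2 by (auto simp: k_def add_nonneg_pos)
  have "ennreal (s0 / k) \<le> ennreal \<rho> * dil_norm \<Phi>1 l * dil_norm \<Phi>2 l * dil_norm \<Phi>3 (1 / l)"
    if l: "l > 0" and \<rho>: "\<rho> > 0" and
      big: "\<forall>z\<in>{-\<delta>..\<delta>}. c \<le> \<rho> * cmod (bilinear_op M (wave a y l) (wave b y' l) (1 / l * z))"
    for l \<rho> a b y y'
  proof -
    let ?B = "bilinear_op M (wave a y l) (wave b y' l)"
    let ?P = "ennreal \<rho> * dil_norm \<Phi>1 l * dil_norm \<Phi>2 l * dil_norm \<Phi>3 (1 / l)"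
    have meas: "?B \<in> borel_measurable lebesgue"
      by (intro bilinear_op_measurable fourier_wave_measurable l M)
    have NB: "lux_norm \<Phi>3 ?B \<le> ennreal C * lux_norm \<Phi>1 (wave a y l) * lux_norm \<Phi>2 (wave b y' l)"
      by (intro C wave_paley_wiener l)
    also have "\<dots> < \<infinity>"
      using lux_norm_wave_finite[OF young(1) l] lux_norm_wave_finite[OF young(2) l]
      by (simp add: ennreal_mult_less_top)
    finally have fin: "lux_norm \<Phi>3 ?B < \<infinity>" .
    have "ennreal s0 \<le> lux_norm \<Phi>3 (\<lambda>z. of_real \<rho> * dilation (1 / l) ?B z)"
      using big \<rho> by (intro s0) (simp add: dilation_def norm_mult)
    also have "\<dots> \<le> ennreal \<rho> * lux_norm \<Phi>3 (dilation (1 / l) ?B)"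
      by (rule lux_norm_cmult_le[OF \<rho>])
    also have "\<dots> \<le> ennreal \<rho> * (dil_norm \<Phi>3 (1 / l) * lux_norm \<Phi>3 ?B)"
      using l by (intro mult_left_mono lux_norm_dilation_le_dil_norm young meas fin) auto
    also have "\<dots> \<le> ennreal \<rho> * (dil_norm \<Phi>3 (1 / l) *
        (ennreal C * (dil_norm \<Phi>1 l * ennreal r1) * (dil_norm \<Phi>2 l * ennreal r2)))"
      using lux_norm_wave_le[OF young(1) l] lux_norm_wave_le[OF young(2) l] unfolding r1 r2
      by (intro mult_left_mono order_trans[OF NB] mult_mono) auto
    also have "\<dots> = ?P * ennreal (C * r1 * r2)"
      using C r1 r2 by (simp add: ennreal_mult mult_ac)
    also have "\<dots> \<le> ?P * ennreal k"
      using k by (intro mult_left_mono ennreal_leI) auto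
    finally have "ennreal (1 / k) * ennreal s0 \<le> ennreal (1 / k) * (?P * ennreal k)"
      by (rule mult_left_mono) simp
    also have "\<dots> = (ennreal (1 / k) * ennreal k) * ?P" by (simp only: mult_ac)
    also have "ennreal (1 / k) * ennreal k = 1" using k by (simp flip: ennreal_mult)
    finally show ?thesis using k s0 by (simp flip: ennreal_mult)
  qed
  moreover have "ennreal (s0 / k) > 0" using s0 k by simp
  ultimately show ?thesis by blast
qed

text \<open>If the transform of \<^term>\<open>M\<close> vanished, the multiplication formula would make \<^term>\<open>M\<close>
  orthogonal to the transforms of all waves, hence to arbitrarily narrow tents around
  \<^term>\<open>x0\<close>. By continuity the averages against these tents detect the value \<^term>\<open>M x0\<close>.\<close>

lemma fourier_nonzero_somewhere:
  fixes M :: "real \<Rightarrow> complex"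
  assumes cont: "continuous_on UNIV M" and int: "integrable lborel M" and x0: "M x0 \<noteq> 0"
  shows "\<exists>y. (LINT s|lborel. M s * cis (- 2 * pi * s * y)) \<noteq> 0"
proof (rule ccontr)
  assume "\<not> ?thesis"
  then have zero: "(LINT s|lborel. M s * cis (- 2 * pi * s * y)) = 0" for y by simp
  have [measurable]: "M \<in> borel_measurable borel"
    using cont by (rule borel_measurable_continuous_onI)
  have avg: "(LINT u|lborel. M (x0 + e * u) * of_real (tri u)) = 0" if e: "e > 0" for e
  proof -
    let ?w = "wave x0 0 e"
    have fw: "(LINT x|lborel. ?w x * cis (- 2 * pi * s * x)) = of_real (fejer_mass / e * tri ((s - x0) / e))" for s
    proof -
      have "fourier ?w s = (LINT x|lebesgue. ?w x * cis (- 2 * pi * s * x))"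
        by (simp add: fourier_def cis_conv_exp mult_ac)
      also have "\<dots> = (LINT x|lborel. ?w x * cis (- 2 * pi * s * x))"
        by (rule integral_completion) (unfold cis_conv_exp, measurable)
      finally show ?thesis using fourier_wave[OF e, of x0 0 s] by simp
    qed
    have "integrable (lborel \<Otimes>\<^sub>M lborel) (\<lambda>p. M (fst p) * ?w (snd p) * cis (- 2 * pi * fst p * snd p))"
    proof (rule Bochner_Integration.integrable_bound)
      show "integrable (lborel \<Otimes>\<^sub>M lborel) (\<lambda>p. cmod (M (fst p)) * cmod (?w (snd p)))"
        using int wave_integrable[OF e] by (intro integrable_product_real integrable_norm)
      show "(\<lambda>p. M (fst p) * ?w (snd p) * cis (- 2 * pi * fst p * snd p))
          \<in> borel_measurable (lborel \<Otimes>\<^sub>M lborel)"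
        unfolding cis_conv_exp by measurable
    qed (simp add: norm_mult)
    then have "integrable (lborel \<Otimes>\<^sub>M lborel) (\<lambda>(s, x). M s * ?w x * cis (- 2 * pi * s * x))"
      by (simp add: case_prod_beta')
    then have "(LINT x|lborel. LINT s|lborel. M s * ?w x * cis (- 2 * pi * s * x))
        = (LINT s|lborel. LINT x|lborel. M s * ?w x * cis (- 2 * pi * s * x))"
      by (rule lborel_pair.Fubini_integral)
    moreover have "(LINT s|lborel. M s * ?w x * cis (- 2 * pi * s * x)) = 0" for x
    proof -
      have "(LINT s|lborel. M s * ?w x * cis (- 2 * pi * s * x))
          = (LINT s|lborel. ?w x * (M s * cis (- 2 * pi * s * x)))" by (simp add: mult_ac)
      then show ?thesis using zero[of x] by simp
    qed
    moreover have "(LINT x|lborel. M s * ?w x * cis (- 2 * pi * s * x))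
        = M s * of_real (fejer_mass / e * tri ((s - x0) / e))" for s
      unfolding fw[symmetric] integral_mult_right_zero[symmetric] by (simp add: mult_ac)
    ultimately have "(LINT s|lborel. M s * of_real (fejer_mass / e * tri ((s - x0) / e))) = 0" by simp
    also have "(LINT s|lborel. M s * of_real (fejer_mass / e * tri ((s - x0) / e)))
        = \<bar>e\<bar> *\<^sub>R (LINT u|lborel. M (x0 + e * u) * of_real (fejer_mass / e * tri ((x0 + e * u - x0) / e)))"
      using e by (intro lborel_integral_real_affine) auto
    also have "(\<lambda>u. M (x0 + e * u) * of_real (fejer_mass / e * tri ((x0 + e * u - x0) / e)))
        = (\<lambda>u. of_real (fejer_mass / e) * (M (x0 + e * u) * of_real (tri u)))"
      using e by (auto simp: mult_ac)
    finally show ?thesis using e fejer_mass_pos by simp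
  qed
  obtain B where B: "B \<ge> 0" "\<And>x. \<bar>x - x0\<bar> \<le> 1 \<Longrightarrow> cmod (M x) \<le> B"
    using continuous_locally_bounded[OF cont, of x0 1] by blast
  have "continuous (at 0 within {0..1}) (\<lambda>e. LINT u|lborel. M (x0 + e * u) * of_real (tri u))"
  proof (rule integral_param_continuous)
    show "integrable lborel (\<lambda>u. B * tri u)" using tri_integrable by simp
    show "cmod (M (x0 + e * u) * of_real (tri u)) \<le> B * tri u" if "e \<in> {0..1}" for e u
    proof (cases "\<bar>u\<bar> \<le> 1")
      case True
      then have "\<bar>e * u\<bar> \<le> 1" using that by (auto simp: abs_mult intro!: mult_le_one)
      then show ?thesis using B tri_bounds[of u] by (auto simp: norm_mult intro!: mult_right_mono)
    qed (simp add: tri_eq_0)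
    have "continuous_on UNIV (\<lambda>e. M (x0 + e * u) * of_real (tri u))" for u
      by (intro continuous_intros continuous_on_compose2[OF cont]) auto
    then show "continuous (at 0 within {0..1}) (\<lambda>e. M (x0 + e * u) * of_real (tri u))" for u
      using continuous_on_eq_continuous_at continuous_at_imp_continuous_at_within open_UNIV by blast
  qed auto
  then have "((\<lambda>e. LINT u|lborel. M (x0 + e * u) * of_real (tri u)) \<longlongrightarrow>
      (LINT u|lborel. M x0 * of_real (tri u))) (at 0 within {0..1})"
    by (simp add: continuous_within)
  moreover have "((\<lambda>e. LINT u|lborel. M (x0 + e * u) * of_real (tri u)) \<longlongrightarrow> 0) (at 0 within {0..1})"
    by (rule tendsto_eventually) (auto simp: eventually_at_filter avg)
  moreover have "at (0::real) within {0..1} \<noteq> bot"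
    by (simp add: at_within_Icc_at_right)
  ultimately have "(LINT u|lborel. M x0 * of_real (tri u)) = 0"
    using tendsto_unique by blast
  then show False using x0 integral_tri_power_pos[of 1] by simp
qed

text \<open>The substitution \<open>\<xi> = a + l u\<close>, \<open>\<eta> = l v\<close> makes the multiplier see only
  values near \<^term>\<open>a\<close> when \<^term>\<open>l\<close> is small.\<close>

lemma bilinear_op_wave_modulated:
  assumes l: "l > 0" and M: "M \<in> borel_measurable borel"
  shows "bilinear_op M (wave a 0 l) (wave 0 0 l) (1 / l * z)
       = of_real (fejer_mass\<^sup>2) * cis (2 * pi * (a / l) * z) *
         (LINT v|lborel. LINT u|lborel.
            of_real (tri v * tri u) * M (a + l * (u - v)) * cis (2 * pi * (u + v) * z))"
proof -
  have "bilinear_op M (wave a 0 l) (wave 0 0 l) (1 / l * z)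
      = \<bar>l * l\<bar> *\<^sub>R (LINT v|lborel. LINT u|lborel.
           fourier (wave a 0 l) (a + l * u) * fourier (wave 0 0 l) (l * v) *
           M (a + l * u - l * v) * cis (2 * pi * (a + l * u + l * v) * (1 / l * z)))"
    unfolding bilinear_op_lborel[OF fourier_wave_measurable[OF l] fourier_wave_measurable[OF l] M]
    using l by (intro iterated_integral_affine[where t = "\<lambda>v. a"]) auto
  also have "(\<lambda>v u. fourier (wave a 0 l) (a + l * u) * fourier (wave 0 0 l) (l * v) *
           M (a + l * u - l * v) * cis (2 * pi * (a + l * u + l * v) * (1 / l * z)))
    = (\<lambda>v u. (of_real (fejer_mass\<^sup>2 / l\<^sup>2) * cis (2 * pi * (a / l) * z)) *
         (of_real (tri v * tri u) * M (a + l * (u - v)) * cis (2 * pi * (u + v) * z)))"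
  proof (intro ext)
    fix v u
    have "cis (2 * pi * (a + l * u + l * v) * (1 / l * z))
        = cis (2 * pi * (a / l) * z) * cis (2 * pi * (u + v) * z)"
      unfolding cis_mult by (rule arg_cong[of _ _ cis]) (use l in \<open>simp add: field_simps\<close>)
    then show "fourier (wave a 0 l) (a + l * u) * fourier (wave 0 0 l) (l * v) *
           M (a + l * u - l * v) * cis (2 * pi * (a + l * u + l * v) * (1 / l * z))
      = (of_real (fejer_mass\<^sup>2 / l\<^sup>2) * cis (2 * pi * (a / l) * z)) *
         (of_real (tri v * tri u) * M (a + l * (u - v)) * cis (2 * pi * (u + v) * z))"
      using l by (simp add: fourier_wave algebra_simps power2_eq_square)
  qed
  finally show ?thesis
    using l unfolding integral_mult_right_zero
    by (simp add: scaleR_conv_of_real power2_eq_square)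
qed

text \<open>The substitution \<open>\<xi> = l v + s\<close>, \<open>\<eta> = l v\<close> leaves the multiplier at its own scale,
  so that for large \<^term>\<open>l\<close> it acts like a point mass on the diagonal. The opposite translations of
  the two waves contribute the character at frequency \<^term>\<open>y\<close>, and the mass is the Fourier
  transform of \<^term>\<open>M\<close> at \<^term>\<open>y\<close>.\<close>

lemma bilinear_op_wave_translated:
  assumes l: "l > 0" and M: "M \<in> borel_measurable borel"
  shows "bilinear_op M (wave 0 (- y) l) (wave 0 y l) (1 / l * z)
       = of_real (fejer_mass\<^sup>2 / l) *
         (LINT v|lborel. LINT s|lborel.
            of_real (tri v * tri (v + 1 / l * s)) * (M s * cis (- 2 * pi * s * y)) *
            cis (2 * pi * (2 * v + 1 / l * s) * z))"
proof -
  have "bilinear_op M (wave 0 (- y) l) (wave 0 y l) (1 / l * z)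
      = \<bar>l * 1\<bar> *\<^sub>R (LINT v|lborel. LINT s|lborel.
           fourier (wave 0 (- y) l) (l * v + 1 * s) * fourier (wave 0 y l) (l * v) *
           M (l * v + 1 * s - l * v) * cis (2 * pi * (l * v + 1 * s + l * v) * (1 / l * z)))"
    unfolding bilinear_op_lborel[OF fourier_wave_measurable[OF l] fourier_wave_measurable[OF l] M]
    using l by (intro iterated_integral_affine[where t = "\<lambda>v. l * v"]) auto
  also have "(\<lambda>v s. fourier (wave 0 (- y) l) (l * v + 1 * s) * fourier (wave 0 y l) (l * v) *
           M (l * v + 1 * s - l * v) * cis (2 * pi * (l * v + 1 * s + l * v) * (1 / l * z)))
    = (\<lambda>v s. of_real (fejer_mass\<^sup>2 / l\<^sup>2) *
         (of_real (tri v * tri (v + 1 / l * s)) * (M s * cis (- 2 * pi * s * y)) *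
            cis (2 * pi * (2 * v + 1 / l * s) * z)))"
  proof (intro ext)
    fix v s
    have 1: "cis (2 * pi * (- y) * (l * v + 1 * s - 0)) * cis (2 * pi * y * (l * v - 0))
        = cis (- 2 * pi * s * y)"
      unfolding cis_mult by (rule arg_cong[of _ _ cis]) (simp add: algebra_simps)
    have 2: "2 * pi * (l * v + 1 * s + l * v) * (1 / l * z) = 2 * pi * (2 * v + 1 / l * s) * z"
      using l by (simp add: field_simps)
    have 3: "(l * v + 1 * s - 0) / l = v + 1 / l * s" "(l * v - 0) / l = v"
      using l by (simp_all add: field_simps)
    have "fourier (wave 0 (- y) l) (l * v + 1 * s) * fourier (wave 0 y l) (l * v)
        = (cis (2 * pi * (- y) * (l * v + 1 * s - 0)) * cis (2 * pi * y * (l * v - 0))) *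
          of_real (fejer_mass / l * tri (v + 1 / l * s) * (fejer_mass / l * tri v))"
      unfolding fourier_wave[OF l] 3 by simp
    also have "\<dots> = of_real (fejer_mass\<^sup>2 / l\<^sup>2) *
        (of_real (tri v * tri (v + 1 / l * s)) * cis (- 2 * pi * s * y))"
      unfolding 1 by (simp add: power2_eq_square)
    finally show "fourier (wave 0 (- y) l) (l * v + 1 * s) * fourier (wave 0 y l) (l * v) *
           M (l * v + 1 * s - l * v) * cis (2 * pi * (l * v + 1 * s + l * v) * (1 / l * z))
      = of_real (fejer_mass\<^sup>2 / l\<^sup>2) *
         (of_real (tri v * tri (v + 1 / l * s)) * (M s * cis (- 2 * pi * s * y)) *
            cis (2 * pi * (2 * v + 1 / l * s) * z))"
      unfolding 2 by (simp add: mult_ac)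
  qed
  finally show ?thesis
    using l unfolding integral_mult_right_zero
    by (simp add: scaleR_conv_of_real power2_eq_square)
qed

text \<open>At the origin the integral is \<^term>\<open>M a\<close> times the square of the integral of the tent.\<close>

lemma modulated_bounded_below:
  fixes M :: "real \<Rightarrow> complex"
  assumes cont: "continuous_on UNIV M" and a: "M a \<noteq> 0"
  shows "\<exists>c>0. \<exists>\<delta>>0. \<forall>h z. \<bar>h\<bar> \<le> \<delta> \<longrightarrow> \<bar>z\<bar> \<le> \<delta> \<longrightarrow>
    c \<le> cmod (LINT v|lborel. LINT u|lborel.
            of_real (tri v * tri u) * M (a + h * (u - v)) * cis (2 * pi * (u + v) * z))"
proof -
  have [measurable]: "M \<in> borel_measurable borel"
    using cont by (rule borel_measurable_continuous_onI)
  obtain B where B: "B \<ge> 0" "\<And>x. \<bar>x - a\<bar> \<le> 2 \<Longrightarrow> cmod (M x) \<le> B"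
    using continuous_locally_bounded[OF cont, of a 2] by blast
  show ?thesis
  proof (rule iterated_integral_bounded_below)
    show "integrable lborel (\<lambda>v. B * tri v)" "integrable lborel tri"
      using tri_integrable by auto
    show "(\<lambda>p. of_real (tri (fst p) * tri (snd p)) * M (a + h * (snd p - fst p)) *
        cis (2 * pi * (snd p + fst p) * z)) \<in> borel_measurable (lborel \<Otimes>\<^sub>M lborel)" for h z
      unfolding cis_conv_exp by measurable
    show "cmod (of_real (tri v * tri u) * M (a + h * (u - v)) * cis (2 * pi * (u + v) * z))
        \<le> B * tri v * tri u" if "\<bar>h\<bar> \<le> 1" for h z v u
    proof (cases "\<bar>u\<bar> \<le> 1 \<and> \<bar>v\<bar> \<le> 1")
      case True
      then have "\<bar>h\<bar> * \<bar>u - v\<bar> \<le> 1 * 2" using that by (intro mult_mono) auto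
      then have "cmod (M (a + h * (u - v))) \<le> B" by (intro B) (simp add: abs_mult)
      then have "tri v * tri u * cmod (M (a + h * (u - v))) \<le> tri v * tri u * B"
        using tri_bounds by (intro mult_left_mono) auto
      then show ?thesis using tri_bounds[of u] tri_bounds[of v] by (simp add: norm_mult mult_ac)
    qed (auto simp: tri_eq_0)
    show "continuous_on UNIV (\<lambda>q. of_real (tri v * tri u) * M (a + fst q * (u - v)) *
        cis (2 * pi * (u + v) * snd q))" for v u
      by (intro continuous_intros continuous_on_compose2[OF cont]) auto
    have "(LINT v|lborel. LINT u|lborel.
            of_real (tri v * tri u) * M (a + 0 * (u - v)) * cis (2 * pi * (u + v) * 0))
        = (LINT v|lborel. of_real (tri v) * (of_real (LINT u|lborel. tri u) * M a))"
      by (simp add: mult.assoc)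
    also have "\<dots> = of_real (LINT v|lborel. tri v) * (of_real (LINT u|lborel. tri u) * M a)"
      by simp
    also have "\<dots> \<noteq> 0" using a integral_tri_power_pos[of 1] by simp
    finally show "(LINT v|lborel. LINT u|lborel.
            of_real (tri v * tri u) * M (a + 0 * (u - v)) * cis (2 * pi * (u + v) * 0)) \<noteq> 0" .
  qed
qed

text \<open>At the origin the integral splits into that of the squared tent and that of \<^term>\<open>m\<close>.\<close>

lemma translated_bounded_below:
  fixes m :: "real \<Rightarrow> complex"
  assumes int: "integrable lborel m" and nz: "(LINT s|lborel. m s) \<noteq> 0"
  shows "\<exists>c>0. \<exists>\<delta>>0. \<forall>h z. \<bar>h\<bar> \<le> \<delta> \<longrightarrow> \<bar>z\<bar> \<le> \<delta> \<longrightarrow>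
    c \<le> cmod (LINT v|lborel. LINT s|lborel.
            of_real (tri v * tri (v + h * s)) * m s * cis (2 * pi * (2 * v + h * s) * z))"
proof (rule iterated_integral_bounded_below)
  have [measurable]: "m \<in> borel_measurable borel" using int by auto
  show "integrable lborel tri" "integrable lborel (\<lambda>s. cmod (m s))"
    using tri_integrable int by auto
  show "(\<lambda>p. of_real (tri (fst p) * tri (fst p + h * snd p)) * m (snd p) *
        cis (2 * pi * (2 * fst p + h * snd p) * z)) \<in> borel_measurable (lborel \<Otimes>\<^sub>M lborel)" for h z
    unfolding cis_conv_exp by measurable
  show "cmod (of_real (tri v * tri (v + h * s)) * m s * cis (2 * pi * (2 * v + h * s) * z))
      \<le> tri v * cmod (m s)" for h z v s
    using tri_bounds by (auto simp: norm_mult intro!: mult_right_mono mult_left_le)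
  show "continuous_on UNIV (\<lambda>q. of_real (tri v * tri (v + fst q * s)) * m s *
        cis (2 * pi * (2 * v + fst q * s) * snd q))" for v s
    by (intro continuous_intros continuous_on_compose2[OF tri_continuous]) auto
  have "(LINT v|lborel. LINT s|lborel.
            of_real (tri v * tri (v + 0 * s)) * m s * cis (2 * pi * (2 * v + 0 * s) * 0))
      = (LINT v|lborel. of_real (tri v ^ 2) * (LINT s|lborel. m s))"
    by (simp add: power2_eq_square)
  also have "\<dots> = of_real (LINT v|lborel. tri v ^ 2) * (LINT s|lborel. m s)"
    by (simp only: integral_mult_left_zero integral_complex_of_real)
  also have "\<dots> \<noteq> 0" using nz integral_tri_power_pos(2)[of 2] by (simp del: of_real_power)
  finally show "(LINT v|lborel. LINT s|lborel.
            of_real (tri v * tri (v + 0 * s)) * m s * cis (2 * pi * (2 * v + 0 * s) * 0)) \<noteq> 0" .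
qed

section \<open>Lower bounds for the dilation norms\<close>

theorem theorem5p5:
  fixes \<Phi>1 \<Phi>2 \<Phi>3 :: "real \<Rightarrow> ennreal"
  assumes "young \<Phi>1" and "young \<Phi>2" and "young \<Phi>3"
    and "\<exists>M \<in> bilinear_multipliers \<Phi>1 \<Phi>2 \<Phi>3.
           (\<exists>x. M x \<noteq> 0) \<and> continuous_on UNIV M \<and> integrable lebesgue M"
  shows "Liminf (at_right 0)
           (\<lambda>l::real. dil_norm \<Phi>1 l * dil_norm \<Phi>2 l * dil_norm \<Phi>3 (1 / l)) > 0
       \<and> Liminf at_top
           (\<lambda>l::real. ennreal l * dil_norm \<Phi>1 l * dil_norm \<Phi>2 l * dil_norm \<Phi>3 (1 / l)) > 0"
proof -
  obtain M a where M: "M \<in> bilinear_multipliers \<Phi>1 \<Phi>2 \<Phi>3" "M a \<noteq> 0" "continuous_on UNIV M"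
    "integrable lebesgue M"
    using assms(4) by blast
  have meas [measurable]: "M \<in> borel_measurable borel"
    using M(3) by (rule borel_measurable_continuous_onI)
  have int: "integrable lborel M" using M(4) by (simp add: integrable_completion)
  have \<kappa>: "fejer_mass\<^sup>2 > 0" using fejer_mass_pos by simp
  show ?thesis
  proof
    let ?G = "\<lambda>h z. LINT v|lborel. LINT u|lborel.
        of_real (tri v * tri u) * M (a + h * (u - v)) * cis (2 * pi * (u + v) * z)"
    obtain c \<delta> where c: "c > 0" and \<delta>: "\<delta> > 0"
      and G: "\<And>h z. \<bar>h\<bar> \<le> \<delta> \<Longrightarrow> \<bar>z\<bar> \<le> \<delta> \<Longrightarrow> c \<le> cmod (?G h z)"
      using modulated_bounded_below[OF M(3,2)] by blast
    obtain \<epsilon> where \<epsilon>: "\<epsilon> > 0" "\<And>l \<rho> a b y y'. l > 0 \<Longrightarrow> \<rho> > 0 \<Longrightarrow>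
       (\<forall>z\<in>{-\<delta>..\<delta>}. fejer_mass\<^sup>2 * c \<le> \<rho> * cmod (bilinear_op M (wave a y l) (wave b y' l) (1 / l * z))) \<Longrightarrow>
       \<epsilon> \<le> ennreal \<rho> * dil_norm \<Phi>1 l * dil_norm \<Phi>2 l * dil_norm \<Phi>3 (1 / l)"
      using multiplier_scaling[OF assms(1-3) M(1) meas mult_pos_pos[OF \<kappa> c] \<delta>] by blast
    have "\<epsilon> \<le> dil_norm \<Phi>1 l * dil_norm \<Phi>2 l * dil_norm \<Phi>3 (1 / l)" if l: "0 < l" "l < \<delta>" for l
    proof -
      have "fejer_mass\<^sup>2 * c \<le> 1 * cmod (bilinear_op M (wave a 0 l) (wave 0 0 l) (1 / l * z))"
        if "z \<in> {-\<delta>..\<delta>}" for z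
      proof -
        have "c \<le> cmod (?G l z)" using G[of l z] l that by (auto simp: abs_le_iff)
        then have "fejer_mass\<^sup>2 * c \<le> fejer_mass\<^sup>2 * cmod (?G l z)"
          using \<kappa> by (intro mult_left_mono) auto
        also have "\<dots> = 1 * cmod (bilinear_op M (wave a 0 l) (wave 0 0 l) (1 / l * z))"
          unfolding bilinear_op_wave_modulated[OF l(1) meas] norm_mult norm_of_real by simp
        finally show ?thesis .
      qed
      then show ?thesis using \<epsilon>(2)[of l 1 a 0 0 0] l by simp
    qed
    then have "\<forall>\<^sub>F l in at_right 0. \<epsilon> \<le> dil_norm \<Phi>1 l * dil_norm \<Phi>2 l * dil_norm \<Phi>3 (1 / l)"
      unfolding eventually_at_right_field using \<delta> by blast
    then show "0 < Liminf (at_right 0) (\<lambda>l. dil_norm \<Phi>1 l * dil_norm \<Phi>2 l * dil_norm \<Phi>3 (1 / l))"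
      by (rule less_le_trans[OF \<epsilon>(1) Liminf_bounded])
  next
    obtain y where y: "(LINT s|lborel. M s * cis (- 2 * pi * s * y)) \<noteq> 0"
      using fourier_nonzero_somewhere[OF M(3) int M(2)] by blast
    let ?m = "\<lambda>s. M s * cis (- 2 * pi * s * y)"
    let ?G = "\<lambda>h z. LINT v|lborel. LINT s|lborel.
        of_real (tri v * tri (v + h * s)) * ?m s * cis (2 * pi * (2 * v + h * s) * z)"
    have "integrable lborel ?m"
    proof (rule Bochner_Integration.integrable_bound[OF int])
      show "?m \<in> borel_measurable lborel" unfolding cis_conv_exp by measurable
    qed (simp add: norm_mult)
    from translated_bounded_below[OF this y] obtain c \<delta> where c: "c > 0" and \<delta>: "\<delta> > 0"
      and G: "\<And>h z. \<bar>h\<bar> \<le> \<delta> \<Longrightarrow> \<bar>z\<bar> \<le> \<delta> \<Longrightarrow> c \<le> cmod (?G h z)"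
      by blast
    obtain \<epsilon> where \<epsilon>: "\<epsilon> > 0" "\<And>l \<rho> a b y y'. l > 0 \<Longrightarrow> \<rho> > 0 \<Longrightarrow>
       (\<forall>z\<in>{-\<delta>..\<delta>}. fejer_mass\<^sup>2 * c \<le> \<rho> * cmod (bilinear_op M (wave a y l) (wave b y' l) (1 / l * z))) \<Longrightarrow>
       \<epsilon> \<le> ennreal \<rho> * dil_norm \<Phi>1 l * dil_norm \<Phi>2 l * dil_norm \<Phi>3 (1 / l)"
      using multiplier_scaling[OF assms(1-3) M(1) meas mult_pos_pos[OF \<kappa> c] \<delta>] by blast
    have "\<epsilon> \<le> ennreal l * dil_norm \<Phi>1 l * dil_norm \<Phi>2 l * dil_norm \<Phi>3 (1 / l)"
      if "1 / \<delta> \<le> l" for l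
    proof -
      have l: "l > 0" using that \<delta> by (meson less_le_trans zero_less_divide_1_iff)
      then have l\<delta>: "\<bar>1 / l\<bar> \<le> \<delta>" using that \<delta> by (simp add: field_simps)
      have "fejer_mass\<^sup>2 * c \<le> l * cmod (bilinear_op M (wave 0 (- y) l) (wave 0 y l) (1 / l * z))"
        if "z \<in> {-\<delta>..\<delta>}" for z
      proof -
        have "c \<le> cmod (?G (1 / l) z)" using G[OF l\<delta>, of z] that by auto
        then have "fejer_mass\<^sup>2 * c \<le> fejer_mass\<^sup>2 * cmod (?G (1 / l) z)"
          using \<kappa> by (intro mult_left_mono) auto
        also have "\<dots> = l * cmod (bilinear_op M (wave 0 (- y) l) (wave 0 y l) (1 / l * z))"
          unfolding bilinear_op_wave_translated[OF l meas] norm_mult norm_of_real using l by simp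
        finally show ?thesis .
      qed
      then show ?thesis using \<epsilon>(2)[of l l 0 "- y" 0 y] l by simp
    qed
    then have "\<forall>\<^sub>F l in at_top. \<epsilon> \<le> ennreal l * dil_norm \<Phi>1 l * dil_norm \<Phi>2 l * dil_norm \<Phi>3 (1 / l)"
      unfolding eventually_at_top_linorder by blast
    then show "0 < Liminf at_top (\<lambda>l. ennreal l * dil_norm \<Phi>1 l * dil_norm \<Phi>2 l * dil_norm \<Phi>3 (1 / l))"
      by (rule less_le_trans[OF \<epsilon>(1) Liminf_bounded])
  qed
qed

end
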